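(* For every positive integer $n$ there exists a set $P_n$ of $n^2$ points in $\mathbb{R}^2$ which can be covered with $n$ lines, such that no subset of $P_n$ of size $\Omega(n^2)$ can be contained in a projective transformation of a rectangular grid of size $o(n^3)$. Explicitly: the sets $P_n$ can be chosen so that for every constant $c>0$ there is a constant $c'>0$ such that, for every $n$, every subset $P'\subseteq P_n$ with $|P'|\geq c\,n^2$, and all positive integers $s,t$, if $P'$ is contained in an $s\times t$ grid, then $st\geq c'n^3$.
   Context: A set of lines covers a point set if every point of the set lies on at least one of the lines. $[k]=\{1,\ldots,k\}$. An $s\times t$ grid is a point set in $\mathbb{R}^2$ of the form $f([t]\times[s])$, where $f$ is an (invertible) projective transformation of the plane that sends all points of $[t]\times[s]$ to points of $\mathbb{R}^2$ (none to infinity). The size of an $s\times t$ grid is $st$. *)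

theory Defs
  imports "HOL-Analysis.Analysis"
begin

definition is_line :: "(real^2) set \<Rightarrow> bool" where
  "is_line l \<longleftrightarrow> affine l \<and> aff_dim l = 1"

definition covered_by_lines :: "(real^2) set \<Rightarrow> nat \<Rightarrow> bool" where
  "covered_by_lines P n \<longleftrightarrow>
     (\<exists>L. finite L \<and> card L = n \<and> (\<forall>l\<in>L. is_line l) \<and> P \<subseteq> \<Union>L)"

text \<open>
  The real projective plane is described by homogeneous coordinates: a point \<open>(x, y)\<close> of the
  affine plane is the class of \<open>(x, y, 1)\<close>, and the class of a nonzero vector \<open>(a, b, w)\<close> is
  the affine point \<open>(a/w, b/w)\<close> if \<open>w \<noteq> 0\<close> and a point at infinity if \<open>w = 0\<close>.
  The projective transformations are the maps induced by invertible \<open>3 \<times> 3\<close> matrices.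
\<close>

definition homog :: "real^2 \<Rightarrow> real^3" where
  "homog p = vector [p $ 1, p $ 2, 1]"

definition dehomog :: "real^3 \<Rightarrow> real^2" where
  "dehomog v = vector [v $ 1 / v $ 3, v $ 2 / v $ 3]"

text \<open>
  \<open>proj_map A p\<close> is meaningful only if \<open>sent_to_infinity A p\<close> fails.
\<close>

definition sent_to_infinity :: "real^3^3 \<Rightarrow> real^2 \<Rightarrow> bool" where
  "sent_to_infinity A p \<longleftrightarrow> (A *v homog p) $ 3 = 0"

definition proj_map :: "real^3^3 \<Rightarrow> real^2 \<Rightarrow> real^2" where
  "proj_map A p = dehomog (A *v homog p)"

definition lattice_box :: "nat \<Rightarrow> nat \<Rightarrow> (real^2) set" where
  "lattice_box t s = {vector [real i, real j] | i j. i \<in> {1..t} \<and> j \<in> {1..s}}"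

definition is_grid :: "nat \<Rightarrow> nat \<Rightarrow> (real^2) set \<Rightarrow> bool" where
  "is_grid s t G \<longleftrightarrow>
     (\<exists>A::real^3^3. invertible A \<and> (\<forall>p\<in>lattice_box t s. \<not> sent_to_infinity A p) \<and>
        G = proj_map A ` lattice_box t s)"

end

theory Submission
  imports Defs
begin

text \<open>
  Take the lines \<open>y = i x + i\<^sup>2\<close>, \<open>1 \<le> i \<le> n\<close>, with \<open>n\<close> points on each. They are tangents of a
  parabola, so a point of the projective plane, also one at infinity, lies on at most two of them.
  If \<open>P'\<close> contains \<open>c n\<^sup>2\<close> of the points, then at least \<open>c n / 2\<close> of the lines contain
  \<open>k \<ge> c n / 2\<close> points of \<open>P'\<close> each. Pulled back to the box \<open>[t] \<times> [s]\<close>, such a line contains \<open>k\<close>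
  lattice points, so its primitive direction \<open>(a, b)\<close> satisfies \<open>\<bar>a\<bar> (k - 1) < t\<close> and
  \<open>\<bar>b\<bar> (k - 1) < s\<close>. Every direction is a point at infinity and hence is used at most twice.
  Counting the directions gives \<open>c n / 2 = O(s t / n\<^sup>2)\<close>.
\<close>

section \<open>Tangents of the parabola y = -x^2/4\<close>

text \<open>Homogeneous line coordinates: a projective point \<open>v\<close> lies on the tangent
  iff the inner product with \<open>v\<close> vanishes, and points at infinity need no separate
  treatment.\<close>

definition tangent_coeffs :: "nat \<Rightarrow> real^3" where
  "tangent_coeffs i = vector [real i, -1, (real i)\<^sup>2]"

lemma tangent_coeffs_inner:
  "tangent_coeffs i \<bullet> v = real i * v $ 1 - v $ 2 + (real i)\<^sup>2 * v $ 3"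
  by (simp add: tangent_coeffs_def inner_vec_def sum_3)

lemma tangent_coeffs_nonzero: "tangent_coeffs i \<noteq> 0"
proof
  assume "tangent_coeffs i = 0"
  then have "tangent_coeffs i $ 2 = 0" by simp
  then show False by (simp add: tangent_coeffs_def)
qed

text \<open>For fixed \<open>v\<close>, incidence is a polynomial equation in \<open>i\<close> of
  degree at most 2. Its coefficients are, up to sign, the entries of \<open>v\<close>, so it is not
  the zero polynomial. The case \<open>v $ 3 = 0\<close> is that of a point at infinity, hence of a
  direction.\<close>

lemma card_tangents_through_le_2:
  assumes "v \<noteq> 0"
  shows "finite {i. tangent_coeffs i \<bullet> v = 0}" "card {i. tangent_coeffs i \<bullet> v = 0} \<le> 2"
proof -
  define p where "p = [:- (v $ 2), v $ 1, v $ 3:]"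
  have "p \<noteq> 0"
    using assms by (auto simp: p_def vec_eq_iff forall_3)
  have fin: "finite {x. poly p x = 0}"
    using \<open>p \<noteq> 0\<close> by (rule poly_roots_finite)
  have "degree p \<le> 2"
    by (simp add: p_def)
  then have c: "card {x. poly p x = 0} \<le> 2"
    using card_poly_roots_bound[OF \<open>p \<noteq> 0\<close>] by linarith
  have sub: "real ` {i. tangent_coeffs i \<bullet> v = 0} \<subseteq> {x. poly p x = 0}"
    by (auto simp: p_def tangent_coeffs_inner algebra_simps power2_eq_square)
  have inj: "inj_on real {i. tangent_coeffs i \<bullet> v = 0}"
    by (simp add: inj_on_def)
  show "finite {i. tangent_coeffs i \<bullet> v = 0}"
    using finite_subset[OF sub fin] finite_imageD inj by blast
  show "card {i. tangent_coeffs i \<bullet> v = 0} \<le> 2"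
    using card_mono[OF fin sub] card_image[OF inj] c by linarith
qed

section \<open>Lattice points on a line in a box\<close>

lemma int_set_spread:
  fixes M :: "int set"
  assumes "finite M" "M \<noteq> {}"
  shows "int (card M) - 1 \<le> Max M - Min M"
proof -
  have "M \<subseteq> {Min M..Max M}" using assms by auto
  then have "card M \<le> card {Min M..Max M}" by (intro card_mono) auto
  moreover have "Min M \<le> Max M" using assms by simp
  ultimately show ?thesis by simp
qed

text \<open>All points of \<open>S\<close> have the form \<open>(x0 + m * a, y0 + m * b)\<close>
  with \<open>(a, b)\<close> primitive and \<open>m\<close> an integer. The extreme values of
  \<open>m\<close> differ by at least \<open>card S - 1\<close>, and both extreme points lie in the
  box.\<close>

lemma collinear_lattice_points_direction:
  fixes S :: "(int \<times> int) set" and \<alpha> \<beta> \<gamma> :: real and s t :: int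
  assumes S: "S \<subseteq> {1..t} \<times> {1..s}" and two: "2 \<le> card S"
    and nz: "\<alpha> \<noteq> 0 \<or> \<beta> \<noteq> 0"
    and line: "\<And>x y. (x, y) \<in> S \<Longrightarrow> \<alpha> * real_of_int x + \<beta> * real_of_int y + \<gamma> = 0"
  obtains a b :: int where "(a, b) \<noteq> (0, 0)" "\<alpha> * real_of_int a + \<beta> * real_of_int b = 0"
    "\<bar>a\<bar> * (int (card S) - 1) \<le> t" "\<bar>b\<bar> * (int (card S) - 1) \<le> s"
proof -
  have fin: "finite S" using S finite_subset by blast
  obtain p q where pq: "p \<in> S" "q \<in> S" "p \<noteq> q"
    using two card_le_Suc0_iff_eq[OF fin] by fastforce
  obtain x0 y0 x1 y1 where p: "p = (x0, y0)" and q: "q = (x1, y1)"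
    by (cases p, cases q) auto
  \<comment> \<open>Dividing by the gcd makes the direction primitive, so that the other points of
    \<open>S\<close> are reached by integer steps.\<close>
  define g where "g = gcd (x1 - x0) (y1 - y0)"
  define a where "a = (x1 - x0) div g"
  define b where "b = (y1 - y0) div g"
  have g: "g \<noteq> 0" using pq p q by (auto simp: g_def)
  have dx: "x1 - x0 = g * a" and dy: "y1 - y0 = g * b"
    by (simp_all add: a_def b_def g_def)
  have cop: "coprime a b"
    unfolding a_def b_def g_def using g g_def by (intro div_gcd_coprime) auto
  have "\<alpha> * real_of_int (x1 - x0) + \<beta> * real_of_int (y1 - y0) = 0"
    using line[of x0 y0] line[of x1 y1] pq p q by (simp add: algebra_simps)
  then have "real_of_int g * (\<alpha> * real_of_int a + \<beta> * real_of_int b) = 0"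
    unfolding dx dy by (simp add: algebra_simps)
  then have ab: "\<alpha> * real_of_int a + \<beta> * real_of_int b = 0" using g by simp
  have ex: "\<exists>m. r = (x0 + m * a, y0 + m * b)" if r: "r \<in> S" for r
  proof -
    obtain x y where xy: "r = (x, y)" by (cases r)
    have l: "\<alpha> * real_of_int (x - x0) + \<beta> * real_of_int (y - y0) = 0"
      using line[of x0 y0] line[of x y] pq p r xy by (simp add: algebra_simps)
    \<comment> \<open>Both difference vectors are orthogonal to the nonzero vector
      \<open>(\<alpha>, \<beta>)\<close>, so their determinant vanishes.\<close>
    have "\<alpha> * (real_of_int (x - x0) * real_of_int b - real_of_int (y - y0) * real_of_int a) = 0"
      "\<beta> * (real_of_int (x - x0) * real_of_int b - real_of_int (y - y0) * real_of_int a) = 0"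
      using l ab by algebra+
    then have "real_of_int (x - x0) * real_of_int b = real_of_int (y - y0) * real_of_int a"
      using nz by auto
    then have cross: "(x - x0) * b = (y - y0) * a"
      by (metis of_int_eq_iff of_int_mult)
    obtain u v where uv: "u * a + v * b = 1"
      using cop bezout_int[of a b] by (auto simp: coprime_iff_gcd_eq_1)
    \<comment> \<open>The Bezout coefficients recover the step count: they send
      \<open>(m * a, m * b)\<close> to \<open>m\<close>.\<close>
    define m where "m = u * (x - x0) + v * (y - y0)"
    have "m * a = x - x0" "m * b = y - y0"
      unfolding m_def using uv cross by algebra+
    then show ?thesis using xy by (intro exI[of _ m]) auto
  qed
  define M where "M = {m. (x0 + m * a, y0 + m * b) \<in> S}"
  have nz_ab: "a \<noteq> 0 \<or> b \<noteq> 0" using cop by auto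
  have inj: "inj_on (\<lambda>m. (x0 + m * a, y0 + m * b)) M"
    using nz_ab by (auto simp: inj_on_def)
  have img: "S = (\<lambda>m. (x0 + m * a, y0 + m * b)) ` M"
    using ex unfolding M_def by blast
  have cM: "card M = card S" using card_image[OF inj] img by simp
  have finM: "finite M" using fin img inj finite_imageD by metis
  have M0: "M \<noteq> {}" using img pq by auto
  have "Max M \<in> M" "Min M \<in> M" using finM M0 by auto
  then have box: "x0 + Max M * a \<in> {1..t}" "x0 + Min M * a \<in> {1..t}"
      "y0 + Max M * b \<in> {1..s}" "y0 + Min M * b \<in> {1..s}"
    using S unfolding M_def by blast+
  have d0: "0 \<le> Max M - Min M" using finM M0 by simp
  have spread_diff: "\<bar>z\<bar> * (Max M - Min M) = \<bar>(w + Max M * z) - (w + Min M * z)\<bar>" for z w :: int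
  proof -
    have "(w + Max M * z) - (w + Min M * z) = z * (Max M - Min M)"
      by (simp add: algebra_simps)
    then show ?thesis using d0 by (simp only: abs_mult abs_of_nonneg)
  qed
  have sp: "int (card S) - 1 \<le> Max M - Min M" using int_set_spread[OF finM M0] cM by simp
  have "\<bar>a\<bar> * (int (card S) - 1) \<le> \<bar>a\<bar> * (Max M - Min M)"
    using sp by (intro mult_left_mono) auto
  also have "\<dots> = \<bar>(x0 + Max M * a) - (x0 + Min M * a)\<bar>"
    using spread_diff by simp
  also have "\<dots> \<le> t" using box by auto
  finally have A: "\<bar>a\<bar> * (int (card S) - 1) \<le> t" .
  have "\<bar>b\<bar> * (int (card S) - 1) \<le> \<bar>b\<bar> * (Max M - Min M)"
    using sp by (intro mult_left_mono) auto
  also have "\<dots> = \<bar>(y0 + Max M * b) - (y0 + Min M * b)\<bar>"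
    using spread_diff by simp
  also have "\<dots> \<le> s" using box by auto
  finally have B: "\<bar>b\<bar> * (int (card S) - 1) \<le> s" .
  show ?thesis using that[of a b] nz_ab ab A B by auto
qed

section \<open>Counting directions\<close>

text \<open>The set is a symmetric interval with \<open>2 * m + 1\<close> elements, where
  \<open>m\<close> is the floor of \<open>x / k\<close>; as \<open>x / k\<close> is at least 1, the
  extra 1 is absorbed into the factor 3.\<close>

lemma card_int_abs_mult_le:
  fixes k x :: real
  assumes "0 < k" "k \<le> x"
  shows "finite {a::int. \<bar>real_of_int a\<bar> * k \<le> x}"
    and "real (card {a::int. \<bar>real_of_int a\<bar> * k \<le> x}) \<le> 3 * x / k"
proof -
  define m where "m = \<lfloor>x / k\<rfloor>"
  have eq: "{a::int. \<bar>real_of_int a\<bar> * k \<le> x} = {-m..m}"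
  proof -
    have "\<bar>real_of_int a\<bar> * k \<le> x \<longleftrightarrow> \<bar>a\<bar> \<le> m" for a :: int
      using assms by (simp add: m_def le_floor_iff pos_le_divide_eq)
    then have "{a::int. \<bar>real_of_int a\<bar> * k \<le> x} = {a. \<bar>a\<bar> \<le> m}" by (simp only:)
    also have "\<dots> = {-m..m}" by auto
    finally show ?thesis .
  qed
  have m1: "1 \<le> m" using assms by (simp add: m_def le_floor_iff)
  have "real_of_int m \<le> x / k" by (simp add: m_def)
  moreover have "1 \<le> x / k" using assms by simp
  moreover have "real (card {-m..m}) = 2 * real_of_int m + 1" using m1 by simp
  ultimately show "real (card {a::int. \<bar>real_of_int a\<bar> * k \<le> x}) \<le> 3 * x / k"
    unfolding eq by simp
  show "finite {a::int. \<bar>real_of_int a\<bar> * k \<le> x}" unfolding eq by simp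
qed

lemma invertible_mult_vec_eq_0_iff:
  fixes A :: "real^'n^'n"
  assumes "invertible A"
  shows "A *v x = 0 \<longleftrightarrow> x = 0"
  using assms matrix_left_invertible_ker[of A] unfolding invertible_def
  by (metis matrix_vector_mult_0_right)

text \<open>Each tangent in \<open>I\<close> is charged to a direction, of which there are at most
  (3t/\<kappa>)(3s/\<kappa>). Since \<open>A\<close> is invertible, a direction becomes a single
  projective point, which is charged at most twice.\<close>

lemma card_tangents_with_directions_le:
  fixes I :: "nat set" and A :: "real^3^3" and s t \<kappa> :: real
  assumes A: "invertible A" and \<kappa>: "0 < \<kappa>" and big: "2 < card I"
    and dir: "\<And>i. i \<in> I \<Longrightarrow> \<exists>a b :: int. (a, b) \<noteq> (0, 0) \<and>
        tangent_coeffs i \<bullet> (A *v vector [real_of_int a, real_of_int b, 0]) = 0 \<and>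
        \<bar>real_of_int a\<bar> * \<kappa> \<le> t \<and> \<bar>real_of_int b\<bar> * \<kappa> \<le> s"
  shows "real (card I) * \<kappa>\<^sup>2 \<le> 18 * (s * t)"
proof -
  have finI: "finite I" using big card.infinite by fastforce
  \<comment> \<open>The image under \<open>A\<close> of the point at infinity in direction
    \<open>(a, b)\<close>.\<close>
  define d :: "int \<times> int \<Rightarrow> real^3" where
    "d = (\<lambda>(a, b). A *v vector [real_of_int a, real_of_int b, 0])"
  have d_nz: "d ab \<noteq> 0" if "ab \<noteq> (0, 0)" for ab
  proof -
    obtain a b where ab: "ab = (a, b)" by (cases ab)
    then have "(vector [real_of_int a, real_of_int b, 0] :: real^3) \<noteq> 0"
      using that by (auto simp: vec_eq_iff forall_3)
    then show ?thesis by (simp add: ab d_def invertible_mult_vec_eq_0_iff[OF A])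
  qed
  have no_common: "\<not> (\<forall>i\<in>I. tangent_coeffs i \<bullet> v = 0)" if "v \<noteq> 0" for v
  proof
    assume "\<forall>i\<in>I. tangent_coeffs i \<bullet> v = 0"
    then have "I \<subseteq> {i. tangent_coeffs i \<bullet> v = 0}" by auto
    from card_mono[OF card_tangents_through_le_2(1)[OF that] this] show False
      using card_tangents_through_le_2(2)[OF that] big by linarith
  qed
  have small: "b = 0" if "\<bar>real_of_int b\<bar> * \<kappa> \<le> x" "x < \<kappa>" for b :: int and x
  proof (rule ccontr)
    assume "b \<noteq> 0"
    then have "1 * \<kappa> \<le> \<bar>real_of_int b\<bar> * \<kappa>" using \<kappa> by (intro mult_right_mono) auto
    then show False using that by simp
  qed
  \<comment> \<open>In a box with \<open>s < \<kappa>\<close> every direction would be horizontal,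
    so all tangents in \<open>I\<close> would pass through the one point \<open>d (1, 0)\<close>.
    More than two cannot.\<close>
  have s: "\<kappa> \<le> s"
  proof (rule ccontr)
    assume "\<not> \<kappa> \<le> s"
    have "tangent_coeffs i \<bullet> d (1, 0) = 0" if "i \<in> I" for i
    proof -
      obtain a b where ab: "(a, b) \<noteq> (0, 0)"
        "tangent_coeffs i \<bullet> (A *v vector [real_of_int a, real_of_int b, 0]) = 0"
        "\<bar>real_of_int b\<bar> * \<kappa> \<le> s" using dir[OF \<open>i \<in> I\<close>] by blast
      have "b = 0" using small ab(3) \<open>\<not> \<kappa> \<le> s\<close> by force
      have "vector [real_of_int a, 0, 0] = real_of_int a *\<^sub>R (vector [1, 0, 0] :: real^3)"
        by (simp add: vec_eq_iff forall_3)
      then show ?thesis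
        using ab \<open>b = 0\<close> by (simp add: d_def scaleR_matrix_vector_assoc[symmetric]
            matrix_vector_mult_scaleR)
    qed
    then show False using no_common[OF d_nz[of "(1, 0)"]] by simp
  qed
  have t: "\<kappa> \<le> t"
  proof (rule ccontr)
    assume "\<not> \<kappa> \<le> t"
    have "tangent_coeffs i \<bullet> d (0, 1) = 0" if "i \<in> I" for i
    proof -
      obtain a b where ab: "(a, b) \<noteq> (0, 0)"
        "tangent_coeffs i \<bullet> (A *v vector [real_of_int a, real_of_int b, 0]) = 0"
        "\<bar>real_of_int a\<bar> * \<kappa> \<le> t" using dir[OF \<open>i \<in> I\<close>] by blast
      have "a = 0" using small ab(3) \<open>\<not> \<kappa> \<le> t\<close> by force
      have "vector [0, real_of_int b, 0] = real_of_int b *\<^sub>R (vector [0, 1, 0] :: real^3)"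
        by (simp add: vec_eq_iff forall_3)
      then show ?thesis
        using ab \<open>a = 0\<close> by (simp add: d_def scaleR_matrix_vector_assoc[symmetric]
            matrix_vector_mult_scaleR)
    qed
    then show False using no_common[OF d_nz[of "(0, 1)"]] by simp
  qed
  define X where "X = {a::int. \<bar>real_of_int a\<bar> * \<kappa> \<le> t}"
  define Y where "Y = {b::int. \<bar>real_of_int b\<bar> * \<kappa> \<le> s}"
  note X = card_int_abs_mult_le[OF \<kappa> t, folded X_def]
  note Y = card_int_abs_mult_le[OF \<kappa> s, folded Y_def]
  \<comment> \<open>The zero vector is removed because it is no projective point and is orthogonal
    to every \<open>tangent_coeffs i\<close>.\<close>
  define D where "D = X \<times> Y - {(0, 0)}"
  have finD: "finite D" using X Y by (simp add: D_def)
  have cov: "I \<subseteq> (\<Union>ab\<in>D. {i. tangent_coeffs i \<bullet> d ab = 0})"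
  proof
    fix i assume "i \<in> I"
    from dir[OF this] obtain a b where "(a, b) \<in> D" "tangent_coeffs i \<bullet> d (a, b) = 0"
      by (auto simp: D_def X_def Y_def d_def)
    then show "i \<in> (\<Union>ab\<in>D. {i. tangent_coeffs i \<bullet> d ab = 0})" by blast
  qed
  have dnz: "d ab \<noteq> 0" if "ab \<in> D" for ab using d_nz that by (simp add: D_def)
  have "card I \<le> card (\<Union>ab\<in>D. {i. tangent_coeffs i \<bullet> d ab = 0})"
    using finD card_tangents_through_le_2(1)[OF dnz] by (intro card_mono[OF _ cov]) auto
  also have "\<dots> \<le> (\<Sum>ab\<in>D. card {i. tangent_coeffs i \<bullet> d ab = 0})"
    by (rule card_UN_le[OF finD])
  also have "\<dots> \<le> (\<Sum>ab\<in>D. 2)"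
    by (intro sum_mono card_tangents_through_le_2(2) dnz)
  also have "\<dots> = 2 * card D" by simp
  also have "\<dots> \<le> 2 * card (X \<times> Y)"
    unfolding D_def using X Y by (intro mult_left_mono card_mono) auto
  finally have "card I \<le> 2 * (card X * card Y)" by (simp add: card_cartesian_product)
  then have "real (card I) \<le> 2 * (real (card X) * real (card Y))"
    by (metis of_nat_le_iff of_nat_mult of_nat_numeral)
  also have "\<dots> \<le> 2 * ((3 * t / \<kappa>) * (3 * s / \<kappa>))"
    using X Y \<kappa> t by (intro mult_left_mono mult_mono) auto
  also have "\<dots> = 18 * (s * t) / \<kappa>\<^sup>2" by (simp add: power2_eq_square)
  finally show ?thesis using \<kappa> by (simp add: pos_le_divide_eq)
qed

section \<open>The point set and its covering lines\<close>

definition tangent_point :: "nat \<times> nat \<Rightarrow> real^2" where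
  "tangent_point = (\<lambda>(i, j). vector [real j, real i * real j + (real i)\<^sup>2])"

text \<open>Tangents \<open>i\<close> and \<open>i'\<close> with different indices meet at abscissa
  -(i + i'), which is negative, whereas the chosen points have positive abscissa
  \<open>j\<close>.\<close>

lemma inj_tangent_point: "inj_on tangent_point ({1..} \<times> {1..})"
proof (rule inj_onI)
  fix p q :: "nat \<times> nat"
  assume pq: "p \<in> {1..} \<times> {1..}" "q \<in> {1..} \<times> {1..}"
    and eq_pq: "tangent_point p = tangent_point q"
  obtain i j i' j' where ij: "p = (i, j)" "q = (i', j')" by (cases p, cases q)
  note eq = eq_pq[unfolded ij]
  have *: "real j = real j' \<and>
      real i * real j + (real i)\<^sup>2 = real i' * real j' + (real i')\<^sup>2"
    using eq[unfolded tangent_point_def vec_eq_iff forall_2 vector_2 prod.case] .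
  have "(real i - real i') * (real j + real i + real i') = 0"
    using conjunct2[OF *] unfolding conjunct1[OF *] by (simp add: algebra_simps power2_eq_square)
  moreover have "real j + real i + real i' \<noteq> 0" using pq unfolding ij by simp
  ultimately show "p = q" using conjunct1[OF *] unfolding ij by simp
qed

lemma tangent_point_on_tangent: "tangent_coeffs i \<bullet> homog (tangent_point (i, j)) = 0"
  by (simp add: tangent_coeffs_inner homog_def tangent_point_def)

lemma covered_by_tangents: "covered_by_lines (tangent_point ` ({1..n} \<times> {1..n})) n"
proof -
  define l where "l i = {x :: real^2. vector [real i, -1] \<bullet> x = - (real i)\<^sup>2}" for i :: nat
  have l_iff: "x \<in> l i \<longleftrightarrow> x $ 2 = real i * x $ 1 + (real i)\<^sup>2" for x i
    by (auto simp: l_def inner_vec_def sum_2)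
  have line: "is_line (l i)" for i
  proof -
    have "(vector [real i, -1] :: real^2) \<noteq> 0"
      by (simp add: vec_eq_iff forall_2)
    then have "aff_dim (l i) = 1"
      unfolding l_def using aff_dim_hyperplane[of "vector [real i, -1] :: real^2"] by simp
    then show ?thesis by (simp add: is_line_def l_def affine_hyperplane)
  qed
  have inj: "inj_on l {1..n}"
  proof (rule inj_onI)
    fix i j assume "l i = l j"
    \<comment> \<open>The intercept with the vertical axis determines the index.\<close>
    then have "vector [0, (real i)\<^sup>2] \<in> l j" using l_iff[of "vector [0, (real i)\<^sup>2]" i] by simp
    then show "i = j" by (simp add: l_iff)
  qed
  have "tangent_point ` ({1..n} \<times> {1..n}) \<subseteq> \<Union> (l ` {1..n})"
    by (auto simp: l_iff tangent_point_def)
  then show ?thesis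
    unfolding covered_by_lines_def using line card_image[OF inj]
    by (intro exI[of _ "l ` {1..n}"]) auto
qed

section \<open>Pulling tangents back to the box\<close>

lemma lattice_box_eq_image:
  "lattice_box t s = (\<lambda>(i, j). vector [real i, real j]) ` ({1..t} \<times> {1..s})"
  unfolding lattice_box_def by fast

text \<open>The preimage of a tangent under \<open>A\<close> is the line with coefficient vector
  \<open>tangent_coeffs i v* A\<close>. It contains at least \<open>card Q\<close> lattice points of
  the box, and its direction is the point at infinity \<open>(a, b, 0)\<close>.\<close>

lemma pulled_back_tangent_direction:
  fixes A :: "real^3^3" and s t :: nat
  assumes A: "invertible A" and fin: "\<And>p. p \<in> lattice_box t s \<Longrightarrow> \<not> sent_to_infinity A p"
    and Q: "Q \<subseteq> proj_map A ` lattice_box t s" "2 \<le> card Q"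
    and on: "\<And>p. p \<in> Q \<Longrightarrow> tangent_coeffs i \<bullet> homog p = 0"
  shows "\<exists>a b :: int. (a, b) \<noteq> (0, 0) \<and>
        tangent_coeffs i \<bullet> (A *v vector [real_of_int a, real_of_int b, 0]) = 0 \<and>
        \<bar>real_of_int a\<bar> * (real (card Q) - 1) \<le> real t \<and>
        \<bar>real_of_int b\<bar> * (real (card Q) - 1) \<le> real s"
proof -
  \<comment> \<open>The box is rewritten over the integers because directions have signed
    coordinates.\<close>
  define e :: "int \<times> int \<Rightarrow> real^2" where "e = (\<lambda>(x, y). vector [real_of_int x, real_of_int y])"
  define S where "S = {r \<in> {1..int t} \<times> {1..int s}. proj_map A (e r) \<in> Q}"
  have box: "lattice_box t s = e ` ({1..int t} \<times> {1..int s})"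
  proof -
    have "lattice_box t s = e ` (map_prod int int ` ({1..t} \<times> {1..s}))"
      by (simp add: lattice_box_eq_image image_image e_def case_prod_beta)
    also have "map_prod int int ` ({1..t} \<times> {1..s}) = {1..int t} \<times> {1..int s}"
      by (simp add: map_prod_surj_on image_int_atLeastAtMost)
    finally show ?thesis .
  qed
  have finS: "finite S" by (simp add: S_def)
  have "Q \<subseteq> (proj_map A \<circ> e) ` S" using Q(1) unfolding box S_def by auto
  then have cQS: "card Q \<le> card S"
    using finS by (meson card_image_le card_mono finite_imageI le_trans)
  define u where "u = tangent_coeffs i v* A"
  have u: "u \<bullet> y = tangent_coeffs i \<bullet> (A *v y)" for y
    by (simp add: u_def dot_lmul_matrix)
  have u_line: "u $ 1 * real_of_int x + u $ 2 * real_of_int y + u $ 3 = 0"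
    if "(x, y) \<in> S" for x y
  proof -
    define w where "w = A *v homog (e (x, y))"
    have "e (x, y) \<in> lattice_box t s" using that by (auto simp: box S_def)
    then have w3: "w $ 3 \<noteq> 0" using fin by (auto simp: sent_to_infinity_def w_def)
    \<comment> \<open>Homogeneous coordinates agree up to the factor \<open>w $ 3\<close>, and
      incidence does not depend on scaling.\<close>
    have "w = (w $ 3) *\<^sub>R homog (proj_map A (e (x, y)))"
      using w3 by (simp add: vec_eq_iff forall_3 proj_map_def homog_def[of "vector _"] dehomog_def
          flip: w_def)
    moreover have "tangent_coeffs i \<bullet> homog (proj_map A (e (x, y))) = 0"
      using that on by (simp add: S_def)
    ultimately have "tangent_coeffs i \<bullet> w = 0" by (metis inner_scaleR_right mult_zero_right)
    then have "u \<bullet> homog (e (x, y)) = 0" by (simp add: u w_def)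
    then show ?thesis by (simp add: inner_vec_def sum_3 homog_def e_def)
  qed
  \<comment> \<open>As \<open>A\<close> is surjective, \<open>u = 0\<close> would make
    \<open>tangent_coeffs i\<close> orthogonal to itself.\<close>
  have "u \<noteq> 0"
  proof
    assume "u = 0"
    then have "tangent_coeffs i \<bullet> (A *v y) = 0" for y using u[of y] by simp
    moreover obtain B where "A ** B = mat 1" using A unfolding invertible_def by blast
    then have "A *v (B *v tangent_coeffs i) = tangent_coeffs i"
      by (simp add: matrix_vector_mul_assoc)
    ultimately have "tangent_coeffs i \<bullet> tangent_coeffs i = 0" by metis
    then show False using tangent_coeffs_nonzero by simp
  qed
  moreover have "S \<noteq> {}" using cQS Q(2) by auto
  \<comment> \<open>Otherwise \<open>u\<close> would be the line at infinity, which contains no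
    point of the nonempty set \<open>S\<close>.\<close>
  ultimately have nz: "u $ 1 \<noteq> 0 \<or> u $ 2 \<noteq> 0"
    using u_line by (fastforce simp: vec_eq_iff forall_3)
  have "2 \<le> card S" "S \<subseteq> {1..int t} \<times> {1..int s}" using cQS Q(2) by (auto simp: S_def)
  from collinear_lattice_points_direction[OF this(2,1) nz u_line]
  obtain a b :: int where ab: "(a, b) \<noteq> (0, 0)"
      "u $ 1 * real_of_int a + u $ 2 * real_of_int b = 0"
      "\<bar>a\<bar> * (int (card S) - 1) \<le> int t" "\<bar>b\<bar> * (int (card S) - 1) \<le> int s" by blast
  have bound: "\<bar>real_of_int x\<bar> * (real (card Q) - 1) \<le> real m"
    if "\<bar>x\<bar> * (int (card S) - 1) \<le> int m" for x :: int and m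
  proof -
    have "\<bar>real_of_int x\<bar> * (real (card Q) - 1) \<le> \<bar>real_of_int x\<bar> * (real (card S) - 1)"
      using cQS by (intro mult_left_mono) auto
    also have "\<dots> = real_of_int (\<bar>x\<bar> * (int (card S) - 1))" by simp
    also have "\<dots> \<le> real_of_int (int m)" using that by (simp only: of_int_le_iff)
    finally show ?thesis by simp
  qed
  have "u \<bullet> vector [real_of_int a, real_of_int b, 0] = 0"
    using ab(2) by (simp add: inner_vec_def sum_3)
  then show ?thesis using ab(1) bound[OF ab(3)] bound[OF ab(4)] unfolding u by blast
qed

section \<open>Rich tangents and the final bound\<close>

text \<open>Averaging: the indices below the threshold contribute at most c n^2 / 2 in total, so the
  others contribute at least as much as remains, and each of them at most \<open>n\<close>.\<close>

lemma card_rich_indices_ge: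
  fixes m :: "nat \<Rightarrow> nat" and c :: real
  assumes "0 < c" "1 \<le> n" "\<And>i. i \<in> {1..n} \<Longrightarrow> m i \<le> n" "c * (real n)\<^sup>2 \<le> real (\<Sum>i=1..n. m i)"
  shows "c * real n / 2 \<le> real (card {i \<in> {1..n}. c * real n / 2 \<le> real (m i)})"
proof -
  define I where "I = {i \<in> {1..n}. c * real n / 2 \<le> real (m i)}"
  have "c * (real n)\<^sup>2 \<le> (\<Sum>i=1..n. real (m i))" using assms(4) by simp
  also have "\<dots> \<le> (\<Sum>i=1..n. (if i \<in> I then real n else 0) + c * real n / 2)"
    using assms by (intro sum_mono) (auto simp: I_def intro: add_increasing2)
  also have "\<dots> = (\<Sum>i=1..n. (if i \<in> I then real n else 0)) + c * (real n)\<^sup>2 / 2"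
    by (simp add: sum.distrib power2_eq_square)
  also have "(\<Sum>i=1..n. (if i \<in> I then real n else 0)) = real (card I) * real n"
  proof -
    have "{1..n} \<inter> I = I" by (auto simp: I_def)
    then show ?thesis by (subst sum.inter_restrict[symmetric]) auto
  qed
  finally have "c * real n / 2 * real n \<le> real (card I) * real n"
    by (simp add: power2_eq_square)
  then show ?thesis using assms(2) by (simp add: I_def)
qed

text \<open>The two terms of the minimum serve two ranges of \<open>n\<close>. For c n < 8 the
  trivial bound st >= |P'| >= c n^2 suffices, since c n / 8 < 1; for larger \<open>n\<close>
  directions are counted.\<close>

lemma grid_size_ge:
  fixes c :: real
  assumes c: "0 < c" and n: "1 \<le> n" and P': "P' \<subseteq> tangent_point ` ({1..n} \<times> {1..n})"
    and cP': "c * (real n)\<^sup>2 \<le> real (card P')" and G: "is_grid s t G" "P' \<subseteq> G"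
  shows "min (c^3 / 576) (c\<^sup>2 / 8) * real n ^ 3 \<le> real (s * t)"
proof -
  obtain A :: "real^3^3" where A: "invertible A"
    "\<And>p. p \<in> lattice_box t s \<Longrightarrow> \<not> sent_to_infinity A p" "G = proj_map A ` lattice_box t s"
    using G(1) unfolding is_grid_def by blast
  show ?thesis
  proof (cases "c * real n < 8")
    case True
    have finG: "finite G" by (simp add: A(3) lattice_box_eq_image)
    have "card G \<le> card ({1..t} \<times> {1..s})"
      unfolding A(3) lattice_box_eq_image image_image by (rule card_image_le) simp
    then have "card P' \<le> s * t"
      using card_mono[OF finG G(2)] by (simp add: mult.commute)
    have "min (c^3 / 576) (c\<^sup>2 / 8) * real n ^ 3 \<le> c\<^sup>2 / 8 * real n ^ 3"
      by (intro mult_right_mono) auto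
    also have "\<dots> = c * (real n)\<^sup>2 * (c * real n / 8)"
      by (simp add: power2_eq_square power3_eq_cube)
    also have "\<dots> \<le> c * (real n)\<^sup>2 * 1"
      using c True by (intro mult_left_mono) auto
    also have "\<dots> \<le> real (card P')" using cP' by simp
    also have "\<dots> \<le> real (s * t)" using \<open>card P' \<le> s * t\<close> by (simp only: of_nat_le_iff)
    finally show ?thesis .
  next
    case False
    define Q where "Q i = P' \<inter> tangent_point ` ({i} \<times> {1..n})" for i
    define I where "I = {i \<in> {1..n}. c * real n / 2 \<le> real (card (Q i))}"
    \<comment> \<open>Half the richness threshold: a rich tangent has at least 2\<kappa> points, and
      2\<kappa> - 1 >= \<kappa> absorbs the loss of one. The split at 8 gives \<kappa> >= 2, hence
      at least 4 rich tangents, more than the two that a single direction allows.\<close>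
    define \<kappa> where "\<kappa> = c * real n / 4"
    have \<kappa>: "2 \<le> \<kappa>" using False by (simp add: \<kappa>_def)
    have "card (Q i) \<le> n" for i
    proof -
      have "card (Q i) \<le> card (tangent_point ` ({i} \<times> {1..n}))"
        unfolding Q_def by (intro card_mono) auto
      also have "\<dots> \<le> card ({i} \<times> {1..n})" by (rule card_image_le) simp
      finally show ?thesis by simp
    qed
    moreover have "card P' \<le> (\<Sum>i=1..n. card (Q i))"
    proof -
      have "P' = (\<Union>i\<in>{1..n}. Q i)" using P' unfolding Q_def by blast
      then show ?thesis using card_UN_le[of "{1..n}" Q] by simp
    qed
    then have "c * (real n)\<^sup>2 \<le> real (\<Sum>i=1..n. card (Q i))"
      using cP' by linarith
    ultimately have cI: "2 * \<kappa> \<le> real (card I)"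
      using card_rich_indices_ge[OF c n, of "\<lambda>i. card (Q i)"] by (simp add: I_def \<kappa>_def)
    have "\<exists>a b :: int. (a, b) \<noteq> (0, 0) \<and>
        tangent_coeffs i \<bullet> (A *v vector [real_of_int a, real_of_int b, 0]) = 0 \<and>
        \<bar>real_of_int a\<bar> * \<kappa> \<le> real t \<and> \<bar>real_of_int b\<bar> * \<kappa> \<le> real s" if "i \<in> I" for i
    proof -
      have k: "2 * \<kappa> \<le> real (card (Q i))" using that by (simp add: I_def \<kappa>_def)
      have two: "2 \<le> card (Q i)" using k \<kappa> by linarith
      have sub: "Q i \<subseteq> proj_map A ` lattice_box t s" using G(2) A(3) by (auto simp: Q_def)
      have on: "tangent_coeffs i \<bullet> homog p = 0" if "p \<in> Q i" for p
        using that tangent_point_on_tangent by (auto simp: Q_def)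
      obtain a b :: int where ab: "(a, b) \<noteq> (0, 0)"
        "tangent_coeffs i \<bullet> (A *v vector [real_of_int a, real_of_int b, 0]) = 0"
        "\<bar>real_of_int a\<bar> * (real (card (Q i)) - 1) \<le> real t"
        "\<bar>real_of_int b\<bar> * (real (card (Q i)) - 1) \<le> real s"
        using pulled_back_tangent_direction[OF A(1,2) sub two on] by blast
      have "\<bar>real_of_int x\<bar> * \<kappa> \<le> \<bar>real_of_int x\<bar> * (real (card (Q i)) - 1)" for x
        using k \<kappa> by (intro mult_left_mono) auto
      then show ?thesis using ab order_trans by blast
    qed
    then have "real (card I) * \<kappa>\<^sup>2 \<le> 18 * (real s * real t)"
      using \<kappa> cI by (intro card_tangents_with_directions_le[OF A(1)]) auto
    moreover have "2 * \<kappa> * \<kappa>\<^sup>2 \<le> real (card I) * \<kappa>\<^sup>2"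
      using cI by (intro mult_right_mono) auto
    ultimately have "2 * \<kappa> * \<kappa>\<^sup>2 \<le> 18 * (real s * real t)" by linarith
    \<comment> \<open>Here 576 = 18 * 4^3 / 2.\<close>
    moreover have "2 * \<kappa> * \<kappa>\<^sup>2 = 18 * (c^3 / 576 * real n ^ 3)"
      by (simp add: \<kappa>_def power2_eq_square power3_eq_cube)
    moreover have "min (c^3 / 576) (c\<^sup>2 / 8) * real n ^ 3 \<le> c^3 / 576 * real n ^ 3"
      by (intro mult_right_mono) auto
    ultimately show ?thesis by simp
  qed
qed

theorem theorem4:
  "\<exists>P :: nat \<Rightarrow> (real^2) set.
     (\<forall>n\<ge>1. finite (P n) \<and> card (P n) = n^2 \<and> covered_by_lines (P n) n) \<and>
     (\<forall>c::real. c > 0 \<longrightarrow>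
        (\<exists>c'::real. c' > 0 \<and>
           (\<forall>n\<ge>1. \<forall>P'. P' \<subseteq> P n \<and> real (card P') \<ge> c * real n ^ 2 \<longrightarrow>
              (\<forall>s t :: nat. \<forall>G. s \<ge> 1 \<and> t \<ge> 1 \<and> is_grid s t G \<and> P' \<subseteq> G \<longrightarrow>
                 real (s * t) \<ge> c' * real n ^ 3))))"
proof (intro exI[of _ "\<lambda>n. tangent_point ` ({1..n} \<times> {1..n})"] conjI allI impI)
  fix n :: nat
  assume "1 \<le> n"
  show "finite (tangent_point ` ({1..n} \<times> {1..n}))" by simp
  have "inj_on tangent_point ({1..n} \<times> {1..n})"
    by (rule inj_on_subset[OF inj_tangent_point]) auto
  then show "card (tangent_point ` ({1..n} \<times> {1..n})) = n\<^sup>2"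
    by (simp add: card_image power2_eq_square)
  show "covered_by_lines (tangent_point ` ({1..n} \<times> {1..n})) n"
    by (rule covered_by_tangents)
next
  fix c :: real
  assume "0 < c"
  have pos: "0 < min (c^3 / 576) (c\<^sup>2 / 8)" using \<open>0 < c\<close> by simp
  show "\<exists>c'>0. \<forall>n\<ge>1. \<forall>P'. P' \<subseteq> tangent_point ` ({1..n} \<times> {1..n}) \<and>
      c * (real n)\<^sup>2 \<le> real (card P') \<longrightarrow>
      (\<forall>s t G. 1 \<le> s \<and> 1 \<le> t \<and> is_grid s t G \<and> P' \<subseteq> G \<longrightarrow>
        c' * real n ^ 3 \<le> real (s * t))"
  proof (rule exI[of _ "min (c^3 / 576) (c\<^sup>2 / 8)"], rule conjI[OF pos], intro allI impI, elim conjE)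
    fix n P' s t G
    assume "1 \<le> n" "P' \<subseteq> tangent_point ` ({1..n} \<times> {1..n})"
      "c * (real n)\<^sup>2 \<le> real (card P')" "is_grid s t G" "P' \<subseteq> G"
    then show "min (c^3 / 576) (c\<^sup>2 / 8) * real n ^ 3 \<le> real (s * t)"
      by (rule grid_size_ge[OF \<open>0 < c\<close>])
  qed
qed

end
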